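(* Let $A$ be a Hilbert algebra, and let $CE$ be the bounded lattice of all closure endomorphisms of $A$. The transformation $\phi \mapsto K_\phi := \{x \in A : \phi x = 1\}$ is an embedding of the bounded lattice $CE$ into the lattice of filters of $A$. Its range consists precisely of the monomial filters of $A$. If $\phi\in CE$ and $J = K_\phi$, then, for all $a \in A$, $\phi a = \max (a/J)$.
   Context: A Hilbert algebra $(A,\to,1)$ is a poset with greatest element $1$ and a binary operation $\to$ such that $x \to y = 1$ iff $x \le y$; $x \le y \to x$; and $x \to (y \to z) \le (x \to y) \to (x \to z)$. A closure endomorphism of $A$ is a map $\phi\colon A\to A$ that is an endomorphism ($\phi(x\to y)=\phi x\to\phi y$) and a closure operator (isotone, $x\le\phi x$, $\phi\phi x=\phi x$). The set $CE$ of all closure endomorphisms of $A$, ordered pointwise, is a bounded (distributive) lattice: join is composition, $\phi\vee\psi=\phi\circ\psi$; meet is pointwise, $(\phi\wedge\psi)x=\phi x\wedge\psi x$ (these meets always exist in $A$); the least element is $\varepsilon\colon x\mapsto x$ and the greatest is $\iota\colon x\mapsto 1$. A filter of $A$ is a subset $J\ni 1$ such that $y\in J$ whenever $x, x\to y\in J$. Filters, ordered by inclusion, form a bounded lattice with meet $\cap$, where the join of two filters is the filter generated by their union; the bounds are $\{1\}$ and $A$. For a filter $J$ and $a\in A$, $a/J$ is the class of $a$ under the congruence $\theta_J$ given by $(a,b)\in\theta_J$ iff $a\to b\in J$ and $b\to a\in J$. A filter $J$ is monomial if every class $a/J$ has a greatest element. *)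

theory Defs
  imports "HOL-Algebra.Lattice"
begin

class hilbert_algebra = order + one +
  fixes himp :: "'a \<Rightarrow> 'a \<Rightarrow> 'a"  (infixr "\<^bold>\<rightarrow>" 60)
  assumes le_one: "x \<le> 1"
    and himp_eq_one_iff: "x \<^bold>\<rightarrow> y = 1 \<longleftrightarrow> x \<le> y"
    and le_himp: "x \<le> y \<^bold>\<rightarrow> x"
    and himp_distrib: "x \<^bold>\<rightarrow> (y \<^bold>\<rightarrow> z) \<le> (x \<^bold>\<rightarrow> y) \<^bold>\<rightarrow> (x \<^bold>\<rightarrow> z)"

definition closure_endo :: "('a::hilbert_algebra \<Rightarrow> 'a) \<Rightarrow> bool" where
  "closure_endo \<phi> \<longleftrightarrow>
     (\<forall>x y. \<phi> (x \<^bold>\<rightarrow> y) = \<phi> x \<^bold>\<rightarrow> \<phi> y) \<and>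
     mono \<phi> \<and> (\<forall>x. x \<le> \<phi> x) \<and> (\<forall>x. \<phi> (\<phi> x) = \<phi> x)"

(* Joins, meets and bounds of the two structures below are the ones HOL-Algebra
   derives from the order (least upper and greatest lower bounds in the carrier).
   The order on functions is pointwise. *)
definition CE :: "('a::hilbert_algebra \<Rightarrow> 'a) gorder" where
  "CE = \<lparr>carrier = {\<phi>. closure_endo \<phi>}, eq = (=), le = (\<le>)\<rparr>"

definition hfilter :: "'a::hilbert_algebra set \<Rightarrow> bool" where
  "hfilter J \<longleftrightarrow> 1 \<in> J \<and> (\<forall>x y. x \<in> J \<longrightarrow> x \<^bold>\<rightarrow> y \<in> J \<longrightarrow> y \<in> J)"

definition hfilter_lattice :: "'a::hilbert_algebra set gorder" where
  "hfilter_lattice = \<lparr>carrier = {J. hfilter J}, eq = (=), le = (\<subseteq>)\<rparr>"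

definition filter_cong :: "'a::hilbert_algebra set \<Rightarrow> ('a \<times> 'a) set" where
  "filter_cong J = {(a, b). a \<^bold>\<rightarrow> b \<in> J \<and> b \<^bold>\<rightarrow> a \<in> J}"

definition filter_class :: "'a::hilbert_algebra \<Rightarrow> 'a set \<Rightarrow> 'a set" where
  "filter_class a J = filter_cong J `` {a}"

definition is_max :: "'a::order set \<Rightarrow> 'a \<Rightarrow> bool" where
  "is_max S m \<longleftrightarrow> m \<in> S \<and> (\<forall>x\<in>S. x \<le> m)"

definition monomial_filter :: "'a::hilbert_algebra set \<Rightarrow> bool" where
  "monomial_filter J \<longleftrightarrow> hfilter J \<and> (\<forall>a. \<exists>m. is_max (filter_class a J) m)"

definition endo_kernel :: "('a::hilbert_algebra \<Rightarrow> 'a) \<Rightarrow> 'a set" where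
  "endo_kernel \<phi> = {x. \<phi> x = 1}"

definition bounded_lattice_embedding ::
    "('a, 'c) gorder_scheme \<Rightarrow> ('b, 'd) gorder_scheme \<Rightarrow> ('a \<Rightarrow> 'b) \<Rightarrow> bool" where
  "bounded_lattice_embedding L M h \<longleftrightarrow>
     bounded_lattice L \<and> bounded_lattice M \<and>
     h \<in> carrier L \<rightarrow> carrier M \<and> inj_on h (carrier L) \<and>
     join_pres L M h \<and> meet_pres L M h \<and>
     h \<bottom>\<^bsub>L\<^esub> = \<bottom>\<^bsub>M\<^esub> \<and> h \<top>\<^bsub>L\<^esub> = \<top>\<^bsub>M\<^esub>"

end

theory Submission
  imports Defs
begin

text \<open>
  A closure endomorphism \<open>\<phi>\<close> turns each gap \<open>\<phi> a \<^bold>\<rightarrow> a\<close> into \<open>\<phi> a \<^bold>\<rightarrow> \<phi> a = 1\<close>, so the gap lies in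
  the kernel (\<open>gap_in_endo_kernel\<close>). Almost everything about kernels comes from this. It makes
  \<open>\<phi> a\<close> congruent to \<open>a\<close> modulo the kernel, and since \<open>\<phi>\<close> is constant on the classes, \<open>\<phi> a\<close> is the
  maximum of the class of \<open>a\<close>. It also lets inclusion of kernels be read back as the pointwise
  order: if the kernel of \<open>\<phi>\<close> is contained in that of \<open>\<psi>\<close>, then \<open>\<psi>\<close> kills the gap, so
  \<open>\<phi> a \<le> \<psi> (\<phi> a) \<le> \<psi> a\<close>. Hence passing to kernels is an order embedding.

  Conversely, let \<open>J\<close> be monomial and \<open>m a\<close> the maximum of the class of \<open>a\<close>. Maximality
  means that elements of \<open>J\<close> act trivially on such maxima: \<open>j \<^bold>\<rightarrow> m a = m a\<close>, because
  \<open>j \<^bold>\<rightarrow> m a\<close> lies above \<open>m a\<close> and is congruent to it. The same then holds for every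
  \<open>m a \<^bold>\<rightarrow> m b\<close>, by exchanging premises, so \<open>m a \<^bold>\<rightarrow> m b\<close> is again the maximum of its class,
  which is the class of \<open>a \<^bold>\<rightarrow> b\<close>. Thus \<open>m\<close> is a closure endomorphism, with kernel \<open>J\<close>.

  Joins: any two closure endomorphisms commute, so their composite is their join; the join of the
  kernels is reached because \<open>\<psi> x\<close> in the one kernel and \<open>\<psi> x \<^bold>\<rightarrow> x\<close> in the other force \<open>x\<close> into
  every filter containing both. Meets: the element \<open>(\<phi> a \<^bold>\<rightarrow> (\<psi> a \<^bold>\<rightarrow> a)) \<^bold>\<rightarrow> a\<close> is the greatest
  lower bound of \<open>\<phi> a\<close> and \<open>\<psi> a\<close>, and it is the maximum of the class of \<open>a\<close> modulo the
  intersection of the kernels. So this intersection is monomial, and the closure endomorphism that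
  belongs to it is the meet.
\<close>

section \<open>Arithmetic of Hilbert algebras\<close>

lemma himp_refl [simp]: "(x :: 'a::hilbert_algebra) \<^bold>\<rightarrow> x = 1"
  by (simp add: himp_eq_one_iff)

lemma himp_one [simp]: "(x :: 'a::hilbert_algebra) \<^bold>\<rightarrow> 1 = 1"
  by (simp add: himp_eq_one_iff le_one)

lemma one_le_iff [simp]: "1 \<le> (x :: 'a::hilbert_algebra) \<longleftrightarrow> x = 1"
  by (auto intro: antisym le_one)

lemma one_himp [simp]: "1 \<^bold>\<rightarrow> (x :: 'a::hilbert_algebra) = x"
proof (rule antisym)
  let ?t = "1 \<^bold>\<rightarrow> x"
  have "?t \<^bold>\<rightarrow> ?t \<le> (?t \<^bold>\<rightarrow> 1) \<^bold>\<rightarrow> (?t \<^bold>\<rightarrow> x)"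
    by (rule himp_distrib)
  then have "1 \<^bold>\<rightarrow> (?t \<^bold>\<rightarrow> x) = 1"
    by simp
  then have "?t \<^bold>\<rightarrow> x = 1"
    by (metis himp_eq_one_iff one_le_iff)
  then show "?t \<le> x"
    unfolding himp_eq_one_iff .
qed (rule le_himp)

lemma himp_antimono_left:
  fixes x :: "'a::hilbert_algebra"
  assumes "x \<le> y"
  shows "y \<^bold>\<rightarrow> z \<le> x \<^bold>\<rightarrow> z"
proof -
  have "x \<^bold>\<rightarrow> y = 1"
    using assms by (simp add: himp_eq_one_iff)
  then have "x \<^bold>\<rightarrow> (y \<^bold>\<rightarrow> z) \<le> x \<^bold>\<rightarrow> z"
    using himp_distrib[of x y z] by simp
  then show ?thesis
    by (rule order_trans[OF le_himp])
qed

lemma himp_exchange: "x \<^bold>\<rightarrow> (y \<^bold>\<rightarrow> z) = y \<^bold>\<rightarrow> ((x :: 'a::hilbert_algebra) \<^bold>\<rightarrow> z)"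
proof -
  have "u \<^bold>\<rightarrow> (v \<^bold>\<rightarrow> z) \<le> v \<^bold>\<rightarrow> (u \<^bold>\<rightarrow> z)" for u v
    using himp_distrib himp_antimono_left[OF le_himp] by (rule order_trans)
  then show ?thesis
    by (blast intro: antisym)
qed

lemma le_himp_himp: "(x :: 'a::hilbert_algebra) \<le> (x \<^bold>\<rightarrow> y) \<^bold>\<rightarrow> y"
proof -
  have "x \<^bold>\<rightarrow> ((x \<^bold>\<rightarrow> y) \<^bold>\<rightarrow> y) = (x \<^bold>\<rightarrow> y) \<^bold>\<rightarrow> (x \<^bold>\<rightarrow> y)"
    by (rule himp_exchange)
  then show ?thesis
    by (simp add: himp_eq_one_iff)
qed

text \<open>The two halves of the compatibility of \<open>\<^bold>\<rightarrow>\<close> with the congruence of a filter.\<close>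

lemma himp_prefix: "y \<^bold>\<rightarrow> z \<le> (x \<^bold>\<rightarrow> y) \<^bold>\<rightarrow> ((x :: 'a::hilbert_algebra) \<^bold>\<rightarrow> z)"
  using le_himp himp_distrib by (rule order_trans)

lemma himp_suffix: "x \<^bold>\<rightarrow> y \<le> (y \<^bold>\<rightarrow> z) \<^bold>\<rightarrow> ((x :: 'a::hilbert_algebra) \<^bold>\<rightarrow> z)"
proof -
  have "(x \<^bold>\<rightarrow> y) \<^bold>\<rightarrow> ((y \<^bold>\<rightarrow> z) \<^bold>\<rightarrow> (x \<^bold>\<rightarrow> z)) = (y \<^bold>\<rightarrow> z) \<^bold>\<rightarrow> ((x \<^bold>\<rightarrow> y) \<^bold>\<rightarrow> (x \<^bold>\<rightarrow> z))"
    by (rule himp_exchange)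
  also have "\<dots> = 1"
    using himp_prefix by (simp add: himp_eq_one_iff)
  finally show ?thesis
    by (simp add: himp_eq_one_iff)
qed


section \<open>Filters and their congruences\<close>

lemma hfilter_one: "hfilter J \<Longrightarrow> 1 \<in> J"
  by (simp add: hfilter_def)

lemma hfilter_mp: "hfilter J \<Longrightarrow> x \<in> J \<Longrightarrow> x \<^bold>\<rightarrow> y \<in> J \<Longrightarrow> y \<in> J"
  unfolding hfilter_def by blast

lemma hfilter_upward: "hfilter J \<Longrightarrow> x \<in> J \<Longrightarrow> x \<le> y \<Longrightarrow> y \<in> J"
  by (metis hfilter_mp hfilter_one himp_eq_one_iff)

lemma hfilter_Inter: "(\<And>J. J \<in> \<J> \<Longrightarrow> hfilter J) \<Longrightarrow> hfilter (\<Inter>\<J>)"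
  unfolding hfilter_def by blast

lemma hfilter_Int: "hfilter J \<Longrightarrow> hfilter K \<Longrightarrow> hfilter (J \<inter> K)"
  unfolding hfilter_def by blast

lemma hfilter_himp_trans:
  assumes "hfilter J" "x \<^bold>\<rightarrow> y \<in> J" "y \<^bold>\<rightarrow> z \<in> J"
  shows "x \<^bold>\<rightarrow> z \<in> J"
  using assms(1,3) hfilter_upward[OF assms(1,2) himp_suffix] by (rule hfilter_mp)

lemma filter_cong_iff: "(a, b) \<in> filter_cong J \<longleftrightarrow> a \<^bold>\<rightarrow> b \<in> J \<and> b \<^bold>\<rightarrow> a \<in> J"
  by (simp add: filter_cong_def)

lemma mem_filter_class_iff: "b \<in> filter_class a J \<longleftrightarrow> (a, b) \<in> filter_cong J"
  by (simp add: filter_class_def)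

lemma filter_cong_sym: "(a, b) \<in> filter_cong J \<Longrightarrow> (b, a) \<in> filter_cong J"
  by (simp add: filter_cong_iff)

lemma filter_cong_refl: "hfilter J \<Longrightarrow> (a, a) \<in> filter_cong J"
  by (simp add: filter_cong_iff hfilter_one)

lemma filter_cong_trans:
  "hfilter J \<Longrightarrow> (a, b) \<in> filter_cong J \<Longrightarrow> (b, c) \<in> filter_cong J \<Longrightarrow> (a, c) \<in> filter_cong J"
  unfolding filter_cong_iff using hfilter_himp_trans by blast

lemma filter_cong_himp:
  assumes J: "hfilter J" and "(a, a') \<in> filter_cong J" "(b, b') \<in> filter_cong J"
  shows "(a \<^bold>\<rightarrow> b, a' \<^bold>\<rightarrow> b') \<in> filter_cong J"
proof (rule filter_cong_trans[OF J])
  show "(a \<^bold>\<rightarrow> b, a \<^bold>\<rightarrow> b') \<in> filter_cong J"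
    using assms unfolding filter_cong_iff by (blast intro: hfilter_upward himp_prefix)
  show "(a \<^bold>\<rightarrow> b', a' \<^bold>\<rightarrow> b') \<in> filter_cong J"
    using assms unfolding filter_cong_iff by (blast intro: hfilter_upward himp_suffix)
qed

text \<open>
  An element of the filter is congruent to \<open>1\<close>, so \<open>j \<^bold>\<rightarrow> m\<close> is congruent to \<open>m\<close>; as the maximum of
  its class, \<open>m\<close> cannot grow under \<open>\<lambda>x. j \<^bold>\<rightarrow> x\<close>.
\<close>

lemma filter_himp_class_max:
  assumes J: "hfilter J" and m: "is_max (filter_class a J) m" and j: "j \<in> J"
  shows "j \<^bold>\<rightarrow> m = m"
proof (rule antisym)
  have am: "(a, m) \<in> filter_cong J"
    using m by (simp add: is_max_def mem_filter_class_iff)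
  have "(j \<^bold>\<rightarrow> m) \<^bold>\<rightarrow> m \<in> J"
    using J j le_himp_himp by (rule hfilter_upward)
  moreover have "m \<^bold>\<rightarrow> (j \<^bold>\<rightarrow> m) \<in> J"
    using J le_himp[of m j] by (metis hfilter_one himp_eq_one_iff)
  ultimately have "(m, j \<^bold>\<rightarrow> m) \<in> filter_cong J"
    by (simp add: filter_cong_iff)
  with J am have "j \<^bold>\<rightarrow> m \<in> filter_class a J"
    unfolding mem_filter_class_iff by (rule filter_cong_trans)
  then show "j \<^bold>\<rightarrow> m \<le> m"
    using m by (simp add: is_max_def)
qed (rule le_himp)


section \<open>Closure endomorphisms and their kernels\<close>

lemma closure_endo_himp: "closure_endo \<phi> \<Longrightarrow> \<phi> (x \<^bold>\<rightarrow> y) = \<phi> x \<^bold>\<rightarrow> \<phi> y"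
  and closure_endo_mono: "closure_endo \<phi> \<Longrightarrow> x \<le> y \<Longrightarrow> \<phi> x \<le> \<phi> y"
  and closure_endo_ge: "closure_endo \<phi> \<Longrightarrow> x \<le> \<phi> x"
  and closure_endo_idem: "closure_endo \<phi> \<Longrightarrow> \<phi> (\<phi> x) = \<phi> x"
  unfolding closure_endo_def by (auto dest: monoD)

lemma closure_endo_one: "closure_endo \<phi> \<Longrightarrow> \<phi> 1 = 1"
  using closure_endo_ge[of \<phi> 1] by simp

lemma closure_endo_id: "closure_endo id"
  by (simp add: closure_endo_def monoI)

lemma closure_endo_const_one: "closure_endo (\<lambda>_. 1)"
  by (simp add: closure_endo_def monoI le_one)

lemma hfilter_endo_kernel: "closure_endo \<phi> \<Longrightarrow> hfilter (endo_kernel \<phi>)"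
  by (auto simp: hfilter_def endo_kernel_def closure_endo_one closure_endo_himp)

lemma gap_in_endo_kernel: "closure_endo \<phi> \<Longrightarrow> \<phi> a \<^bold>\<rightarrow> a \<in> endo_kernel \<phi>"
  by (simp add: endo_kernel_def closure_endo_himp closure_endo_idem)

lemma filter_cong_endo_kernel_iff:
  "closure_endo \<phi> \<Longrightarrow> (a, b) \<in> filter_cong (endo_kernel \<phi>) \<longleftrightarrow> \<phi> a = \<phi> b"
  by (auto simp: filter_cong_iff endo_kernel_def closure_endo_himp himp_eq_one_iff)

lemma is_max_endo_kernel_class:
  assumes "closure_endo \<phi>"
  shows "is_max (filter_class a (endo_kernel \<phi>)) (\<phi> a)"
  using assms closure_endo_ge[OF assms]
  by (simp add: is_max_def mem_filter_class_iff filter_cong_endo_kernel_iff closure_endo_idem)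

lemma monomial_endo_kernel: "closure_endo \<phi> \<Longrightarrow> monomial_filter (endo_kernel \<phi>)"
  unfolding monomial_filter_def using hfilter_endo_kernel is_max_endo_kernel_class by blast

lemma endo_kernel_subset_iff:
  assumes \<phi>: "closure_endo \<phi>" and \<psi>: "closure_endo \<psi>"
  shows "endo_kernel \<phi> \<subseteq> endo_kernel \<psi> \<longleftrightarrow> \<phi> \<le> \<psi>"
proof
  assume "endo_kernel \<phi> \<subseteq> endo_kernel \<psi>"
  then have "\<psi> (\<phi> a \<^bold>\<rightarrow> a) = 1" for a
    using gap_in_endo_kernel[OF \<phi>, of a] by (auto simp: endo_kernel_def)
  then have "\<psi> (\<phi> a) \<le> \<psi> a" for a
    by (simp add: closure_endo_himp[OF \<psi>] himp_eq_one_iff)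
  then show "\<phi> \<le> \<psi>"
    by (intro le_funI) (blast intro: order_trans closure_endo_ge[OF \<psi>])
next
  assume "\<phi> \<le> \<psi>"
  then show "endo_kernel \<phi> \<subseteq> endo_kernel \<psi>"
    by (auto simp: endo_kernel_def le_fun_def) (metis one_le_iff)
qed

text \<open>
  The converse to \<open>monomial_endo_kernel\<close>. In the inequality \<open>m (a \<^bold>\<rightarrow> b) \<le> m a \<^bold>\<rightarrow> m b\<close>, the element
  \<open>j = m (a \<^bold>\<rightarrow> b) \<^bold>\<rightarrow> (m a \<^bold>\<rightarrow> m b)\<close> is only known to lie in \<open>J\<close>, but that suffices since \<open>j\<close> acts
  trivially on \<open>m b\<close> and hence on \<open>m a \<^bold>\<rightarrow> m b\<close>.
\<close>

lemma closure_endo_of_class_max: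
  assumes J: "hfilter J" and m: "\<And>a. is_max (filter_class a J) (m a)"
  shows "closure_endo m" and "endo_kernel m = J"
proof -
  have cong_m: "(a, m a) \<in> filter_cong J" for a
    using m[of a] by (simp add: is_max_def mem_filter_class_iff)
  have max_m: "b \<le> m a" if "(a, b) \<in> filter_cong J" for a b
    using m[of a] that by (simp add: is_max_def mem_filter_class_iff)
  have ge: "a \<le> m a" for a
    using filter_cong_refl[OF J] by (rule max_m)
  have idem: "m (m a) = m a" for a
    by (intro antisym max_m ge filter_cong_trans[OF J cong_m cong_m])
  have hom: "m (a \<^bold>\<rightarrow> b) = m a \<^bold>\<rightarrow> m b" for a b
  proof (rule antisym)
    have cong: "(a \<^bold>\<rightarrow> b, m a \<^bold>\<rightarrow> m b) \<in> filter_cong J"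
      using J cong_m cong_m by (rule filter_cong_himp)
    then show "m a \<^bold>\<rightarrow> m b \<le> m (a \<^bold>\<rightarrow> b)"
      by (rule max_m)
    define j where "j = m (a \<^bold>\<rightarrow> b) \<^bold>\<rightarrow> (m a \<^bold>\<rightarrow> m b)"
    have "(m (a \<^bold>\<rightarrow> b), m a \<^bold>\<rightarrow> m b) \<in> filter_cong J"
      using J filter_cong_sym[OF cong_m] cong by (rule filter_cong_trans)
    then have "j \<in> J"
      by (simp add: filter_cong_iff j_def)
    have "m (a \<^bold>\<rightarrow> b) \<le> j \<^bold>\<rightarrow> (m a \<^bold>\<rightarrow> m b)"
      unfolding j_def by (rule le_himp_himp)
    also have "\<dots> = m a \<^bold>\<rightarrow> (j \<^bold>\<rightarrow> m b)"
      by (rule himp_exchange)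
    also have "j \<^bold>\<rightarrow> m b = m b"
      using J m \<open>j \<in> J\<close> by (rule filter_himp_class_max)
    finally show "m (a \<^bold>\<rightarrow> b) \<le> m a \<^bold>\<rightarrow> m b" .
  qed
  have "m 1 = 1"
    using ge[of 1] by simp
  then have "mono m"
    using hom by (metis himp_eq_one_iff monoI)
  with ge idem hom show "closure_endo m"
    by (simp add: closure_endo_def)
  have "m a = 1 \<longleftrightarrow> (a, 1) \<in> filter_cong J" for a
    using cong_m[of a] max_m[of a 1] by auto
  then show "endo_kernel m = J"
    using hfilter_one[OF J] by (auto simp: endo_kernel_def filter_cong_iff)
qed

lemma range_endo_kernel: "endo_kernel ` {\<phi>. closure_endo \<phi>} = {J. monomial_filter J}"
proof (intro equalityI subsetI)
  fix J :: "'a set"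
  assume "J \<in> {J. monomial_filter J}"
  then obtain m where "hfilter J" "\<And>a. is_max (filter_class a J) (m a)"
    unfolding monomial_filter_def mem_Collect_eq by metis
  then have "closure_endo m" "endo_kernel m = J"
    by (rule closure_endo_of_class_max)+
  then show "J \<in> endo_kernel ` {\<phi>. closure_endo \<phi>}"
    by blast
qed (auto intro: monomial_endo_kernel)


section \<open>Joins and meets of closure endomorphisms\<close>

lemma closure_endo_commute:
  assumes \<phi>: "closure_endo \<phi>" and \<psi>: "closure_endo \<psi>"
  shows "\<phi> (\<psi> a) = \<psi> (\<phi> a)"
proof -
  have "g (f a) \<le> f (g a)" if f: "closure_endo f" and g: "closure_endo g" for f g :: "'a \<Rightarrow> 'a"
  proof -
    have "f (f a \<^bold>\<rightarrow> a) = 1"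
      using gap_in_endo_kernel[OF f, of a] by (simp add: endo_kernel_def)
    \<comment> \<open>Enlarging the gap by \<open>g\<close> keeps it in the kernel of \<open>f\<close>.\<close>
    then have "f (g (f a \<^bold>\<rightarrow> a)) = 1"
      by (metis closure_endo_ge closure_endo_mono f g one_le_iff)
    then have "f (g (f a)) \<le> f (g a)"
      by (simp add: closure_endo_himp f g himp_eq_one_iff)
    then show ?thesis
      using closure_endo_ge[OF f] order_trans by blast
  qed
  then show ?thesis
    using \<phi> \<psi> by (blast intro: antisym)
qed

lemma closure_endo_comp:
  assumes \<phi>: "closure_endo \<phi>" and \<psi>: "closure_endo \<psi>"
  shows "closure_endo (\<phi> \<circ> \<psi>)"
  unfolding closure_endo_def
proof (intro conjI allI monoI)
  fix x y
  show "(\<phi> \<circ> \<psi>) (x \<^bold>\<rightarrow> y) = (\<phi> \<circ> \<psi>) x \<^bold>\<rightarrow> (\<phi> \<circ> \<psi>) y"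
    by (simp add: closure_endo_himp \<phi> \<psi>)
  show "(\<phi> \<circ> \<psi>) x \<le> (\<phi> \<circ> \<psi>) y" if "x \<le> y"
    using that by (simp add: closure_endo_mono \<phi> \<psi>)
  show "x \<le> (\<phi> \<circ> \<psi>) x"
    using closure_endo_ge[OF \<phi>] closure_endo_ge[OF \<psi>] order_trans by fastforce
  show "(\<phi> \<circ> \<psi>) ((\<phi> \<circ> \<psi>) x) = (\<phi> \<circ> \<psi>) x"
    by (simp add: closure_endo_commute[OF \<psi> \<phi>] closure_endo_idem \<phi> \<psi>)
qed

lemma closure_endo_le_comp:
  assumes \<phi>: "closure_endo \<phi>" and \<psi>: "closure_endo \<psi>"
  shows "\<phi> \<le> \<phi> \<circ> \<psi>" and "\<psi> \<le> \<phi> \<circ> \<psi>"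
  by (simp_all add: le_fun_def closure_endo_mono[OF \<phi>] closure_endo_ge[OF \<psi>] closure_endo_ge[OF \<phi>])

lemma closure_endo_comp_le:
  assumes \<chi>: "closure_endo \<chi>" and "\<phi> \<le> \<chi>" "\<psi> \<le> \<chi>"
  shows "\<phi> \<circ> \<psi> \<le> \<chi>"
proof (rule le_funI)
  fix x
  have "\<phi> (\<psi> x) \<le> \<chi> (\<psi> x)"
    using assms(2) by (rule le_funD)
  also have "\<dots> \<le> \<chi> (\<chi> x)"
    using \<chi> le_funD[OF assms(3)] by (rule closure_endo_mono)
  finally show "(\<phi> \<circ> \<psi>) x \<le> \<chi> x"
    by (simp add: closure_endo_idem[OF \<chi>])
qed

lemma endo_kernel_comp_le:
  assumes \<psi>: "closure_endo \<psi>" and F: "hfilter F"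
    and sub: "endo_kernel \<phi> \<subseteq> F" "endo_kernel \<psi> \<subseteq> F"
  shows "endo_kernel (\<phi> \<circ> \<psi>) \<subseteq> F"
proof
  fix x
  assume "x \<in> endo_kernel (\<phi> \<circ> \<psi>)"
  then have "\<psi> x \<in> F"
    using sub(1) by (auto simp: endo_kernel_def)
  moreover have "\<psi> x \<^bold>\<rightarrow> x \<in> F"
    using gap_in_endo_kernel[OF \<psi>] sub(2) by blast
  ultimately show "x \<in> F"
    by (rule hfilter_mp[OF F])
qed

text \<open>
  In a Boolean algebra \<open>u = (\<phi> a \<^bold>\<rightarrow> (\<psi> a \<^bold>\<rightarrow> a)) \<^bold>\<rightarrow> a\<close> is the meet of \<open>\<phi> a\<close> and \<open>\<psi> a\<close>, joined with
  \<open>a\<close>, which already lies below both. In general, both \<open>\<phi>\<close> and \<open>\<psi>\<close> send the premise of \<open>u\<close> to \<open>1\<close>,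
  so \<open>\<phi> u = \<phi> a\<close> and \<open>\<psi> u = \<psi> a\<close>, which says that \<open>u\<close> is in the class of \<open>a\<close> (and makes it a lower
  bound of \<open>\<phi> a\<close> and \<open>\<psi> a\<close>). Every member of that class is a lower bound of \<open>\<phi> a\<close> and \<open>\<psi> a\<close>, and such
  bounds lie below \<open>u\<close> by modus ponens.
\<close>

lemma is_max_Int_endo_kernel_class:
  assumes \<phi>: "closure_endo \<phi>" and \<psi>: "closure_endo \<psi>"
  shows "is_max (filter_class a (endo_kernel \<phi> \<inter> endo_kernel \<psi>)) ((\<phi> a \<^bold>\<rightarrow> (\<psi> a \<^bold>\<rightarrow> a)) \<^bold>\<rightarrow> a)"
    (is "is_max (filter_class a ?J) ?u")
proof -
  have class_iff: "b \<in> filter_class a ?J \<longleftrightarrow> \<phi> a = \<phi> b \<and> \<psi> a = \<psi> b" for b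
    unfolding mem_filter_class_iff
      filter_cong_endo_kernel_iff[OF \<phi>, symmetric] filter_cong_endo_kernel_iff[OF \<psi>, symmetric]
    by (auto simp: filter_cong_iff)
  have "\<phi> a \<^bold>\<rightarrow> (\<phi> (\<psi> a) \<^bold>\<rightarrow> \<phi> a) = 1"
    using le_himp by (simp add: himp_eq_one_iff)
  then have "\<phi> ?u = \<phi> a"
    by (simp add: closure_endo_himp[OF \<phi>] closure_endo_idem[OF \<phi>])
  moreover have "\<psi> ?u = \<psi> a"
    by (simp add: closure_endo_himp[OF \<psi>] closure_endo_idem[OF \<psi>])
  ultimately have "?u \<in> filter_class a ?J"
    by (simp add: class_iff)
  moreover have "x \<le> ?u" if "x \<in> filter_class a ?J" for x
  proof -
    have x: "x \<le> \<phi> a" "x \<le> \<psi> a"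
      using that closure_endo_ge[OF \<phi>, of x] closure_endo_ge[OF \<psi>, of x] by (auto simp: class_iff)
    have "\<phi> a \<^bold>\<rightarrow> (\<psi> a \<^bold>\<rightarrow> a) \<le> x \<^bold>\<rightarrow> (\<psi> a \<^bold>\<rightarrow> a)"
      using x(1) by (rule himp_antimono_left)
    also have "\<dots> \<le> (x \<^bold>\<rightarrow> \<psi> a) \<^bold>\<rightarrow> (x \<^bold>\<rightarrow> a)"
      by (rule himp_distrib)
    also have "x \<^bold>\<rightarrow> \<psi> a = 1"
      using x(2) by (simp add: himp_eq_one_iff)
    finally have "(\<phi> a \<^bold>\<rightarrow> (\<psi> a \<^bold>\<rightarrow> a)) \<^bold>\<rightarrow> (x \<^bold>\<rightarrow> a) = 1"
      by (simp add: himp_eq_one_iff)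
    then have "x \<^bold>\<rightarrow> ?u = 1"
      by (subst himp_exchange)
    then show ?thesis
      by (simp add: himp_eq_one_iff)
  qed
  ultimately show ?thesis
    by (simp add: is_max_def)
qed

lemma closure_endo_meet_exists:
  assumes "closure_endo \<phi>" "closure_endo \<psi>"
  obtains \<chi> where "closure_endo \<chi>" "endo_kernel \<chi> = endo_kernel \<phi> \<inter> endo_kernel \<psi>"
proof -
  have "hfilter (endo_kernel \<phi> \<inter> endo_kernel \<psi>)"
    by (intro hfilter_Int hfilter_endo_kernel assms)
  note closure_endo_of_class_max[OF this is_max_Int_endo_kernel_class[OF assms]]
  then show thesis
    by (rule that)
qed


section \<open>The two bounded lattices\<close>

lemma CE_simps [simp]:
  "carrier CE = {\<phi>. closure_endo \<phi>}" "eq CE = (=)" "le CE = (\<le>)"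
  by (simp_all add: CE_def)

lemma hfilter_lattice_simps [simp]:
  "carrier hfilter_lattice = {J. hfilter J}" "eq hfilter_lattice = (=)"
  "le hfilter_lattice = (\<subseteq>)"
  by (simp_all add: hfilter_lattice_def)

lemma (in partial_order) join_eqI: "is_lub L s {x, y} \<Longrightarrow> x \<squnion> y = s"
  unfolding join_def sup_def by (blast intro: some_equality least_unique)

lemma (in partial_order) meet_eqI: "is_glb L i {x, y} \<Longrightarrow> x \<sqinter> y = i"
  unfolding meet_def inf_def by (blast intro: some_equality greatest_unique)

lemma (in partial_order) bottom_eqI: "least L b (carrier L) \<Longrightarrow> \<bottom> = b"
  unfolding bottom_def by (blast intro: some_equality least_unique)

lemma (in partial_order) top_eqI: "greatest L t (carrier L) \<Longrightarrow> \<top> = t"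
  unfolding top_def by (blast intro: some_equality greatest_unique)

lemma partial_order_CE: "partial_order CE"
  by unfold_locales auto

lemma partial_order_hfilter_lattice: "partial_order hfilter_lattice"
  by unfold_locales auto

lemma CE_lub:
  assumes "closure_endo \<phi>" "closure_endo \<psi>"
  shows "is_lub CE (\<phi> \<circ> \<psi>) {\<phi>, \<psi>}"
proof (rule least_UpperI)
  fix \<chi>
  assume "\<chi> \<in> Upper CE {\<phi>, \<psi>}"
  then have "closure_endo \<chi>" "\<phi> \<le> \<chi>" "\<psi> \<le> \<chi>"
    using assms by (simp_all add: Upper_def)
  then show "\<phi> \<circ> \<psi> \<sqsubseteq>\<^bsub>CE\<^esub> \<chi>"
    unfolding CE_simps by (rule closure_endo_comp_le)
next
  fix \<chi>
  assume "\<chi> \<in> {\<phi>, \<psi>}"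
  then show "\<chi> \<sqsubseteq>\<^bsub>CE\<^esub> \<phi> \<circ> \<psi>"
    using closure_endo_le_comp[OF assms] unfolding CE_simps by blast
qed (simp_all add: assms closure_endo_comp)

text \<open>Since taking kernels is an order embedding, meets can be recognised by their kernels.\<close>

lemma CE_glb:
  assumes "closure_endo \<phi>" "closure_endo \<psi>" "closure_endo \<chi>"
    and "endo_kernel \<chi> = endo_kernel \<phi> \<inter> endo_kernel \<psi>"
  shows "is_glb CE \<chi> {\<phi>, \<psi>}"
proof -
  have "\<theta> \<le> \<chi> \<longleftrightarrow> \<theta> \<le> \<phi> \<and> \<theta> \<le> \<psi>" if "closure_endo \<theta>" for \<theta>
    using assms that by (simp add: endo_kernel_subset_iff[symmetric])
  from this this[OF assms(3)] assms(1-3) show ?thesis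
    by (simp add: greatest_def Lower_def subset_iff all_conj_distrib imp_conjL)
qed

lemma CE_least: "least CE id (carrier CE)"
  by (auto simp: least_def closure_endo_id le_fun_def closure_endo_ge)

lemma CE_greatest: "greatest CE (\<lambda>_. 1) (carrier CE)"
  by (auto simp: greatest_def closure_endo_const_one le_fun_def le_one)

lemma hfilter_lub:
  assumes "hfilter J" "hfilter K"
  shows "is_lub hfilter_lattice (\<Inter>{F. hfilter F \<and> J \<subseteq> F \<and> K \<subseteq> F}) {J, K}"
  using assms hfilter_Inter[of "{F. hfilter F \<and> J \<subseteq> F \<and> K \<subseteq> F}"]
  by (auto simp: least_def Upper_def)

lemma hfilter_lub_endo_kernel:
  assumes "closure_endo \<phi>" "closure_endo \<psi>"
  shows "is_lub hfilter_lattice (endo_kernel (\<phi> \<circ> \<psi>)) {endo_kernel \<phi>, endo_kernel \<psi>}"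
proof (rule least_UpperI)
  fix F
  assume "F \<in> Upper hfilter_lattice {endo_kernel \<phi>, endo_kernel \<psi>}"
  then have "hfilter F" "endo_kernel \<phi> \<subseteq> F" "endo_kernel \<psi> \<subseteq> F"
    using assms by (auto simp: Upper_def hfilter_endo_kernel)
  then show "endo_kernel (\<phi> \<circ> \<psi>) \<sqsubseteq>\<^bsub>hfilter_lattice\<^esub> F"
    using endo_kernel_comp_le[OF assms(2)] by simp
next
  fix J
  assume "J \<in> {endo_kernel \<phi>, endo_kernel \<psi>}"
  moreover have "endo_kernel \<phi> \<subseteq> endo_kernel (\<phi> \<circ> \<psi>)" "endo_kernel \<psi> \<subseteq> endo_kernel (\<phi> \<circ> \<psi>)"
    using assms by (simp_all add: endo_kernel_subset_iff closure_endo_comp closure_endo_le_comp)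
  ultimately show "J \<sqsubseteq>\<^bsub>hfilter_lattice\<^esub> endo_kernel (\<phi> \<circ> \<psi>)"
    by auto
qed (use assms in \<open>auto simp: hfilter_endo_kernel closure_endo_comp\<close>)

lemma hfilter_glb: "hfilter J \<Longrightarrow> hfilter K \<Longrightarrow> is_glb hfilter_lattice (J \<inter> K) {J, K}"
  by (auto simp: greatest_def Lower_def hfilter_Int)

lemma hfilter_least: "least hfilter_lattice {1} (carrier hfilter_lattice)"
  by (auto simp: least_def hfilter_def)

lemma hfilter_greatest: "greatest hfilter_lattice UNIV (carrier hfilter_lattice)"
  by (auto simp: greatest_def hfilter_def)

lemma bounded_lattice_CE: "bounded_lattice (CE :: ('a::hilbert_algebra \<Rightarrow> 'a) gorder)"
proof -
  interpret partial_order "CE :: ('a \<Rightarrow> 'a) gorder"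
    by (rule partial_order_CE)
  show ?thesis
  proof unfold_locales
    fix \<phi> \<psi> :: "'a \<Rightarrow> 'a"
    assume "\<phi> \<in> carrier CE" "\<psi> \<in> carrier CE"
    then have endo: "closure_endo \<phi>" "closure_endo \<psi>"
      by simp_all
    show "\<exists>s. is_lub CE s {\<phi>, \<psi>}"
      using CE_lub[OF endo] by blast
    obtain \<chi> where "closure_endo \<chi>" "endo_kernel \<chi> = endo_kernel \<phi> \<inter> endo_kernel \<psi>"
      using endo by (rule closure_endo_meet_exists)
    then show "\<exists>s. is_glb CE s {\<phi>, \<psi>}"
      using CE_glb[OF endo] by blast
  qed (use CE_least CE_greatest in blast)+
qed

lemma bounded_lattice_hfilter:
  "bounded_lattice (hfilter_lattice :: 'a::hilbert_algebra set gorder)"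
proof -
  interpret partial_order "hfilter_lattice :: 'a set gorder"
    by (rule partial_order_hfilter_lattice)
  show ?thesis
  proof unfold_locales
    fix J K :: "'a set"
    assume "J \<in> carrier hfilter_lattice" "K \<in> carrier hfilter_lattice"
    then have "hfilter J" "hfilter K"
      by simp_all
    then show "\<exists>s. is_lub hfilter_lattice s {J, K}" "\<exists>s. is_glb hfilter_lattice s {J, K}"
      using hfilter_lub hfilter_glb by blast+
  qed (use hfilter_least hfilter_greatest in blast)+
qed


section \<open>The embedding\<close>

lemma bounded_lattice_embedding_endo_kernel:
  "bounded_lattice_embedding (CE :: ('a::hilbert_algebra \<Rightarrow> 'a) gorder) hfilter_lattice endo_kernel"
proof -
  interpret C: bounded_lattice "CE :: ('a \<Rightarrow> 'a) gorder"
    by (rule bounded_lattice_CE)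
  interpret F: bounded_lattice "hfilter_lattice :: 'a set gorder"
    by (rule bounded_lattice_hfilter)
  have join: "endo_kernel (\<phi> \<squnion>\<^bsub>CE\<^esub> \<psi>) = endo_kernel \<phi> \<squnion>\<^bsub>hfilter_lattice\<^esub> endo_kernel \<psi>"
    if "closure_endo \<phi>" "closure_endo \<psi>" for \<phi> \<psi> :: "'a \<Rightarrow> 'a"
    using C.join_eqI[OF CE_lub[OF that]] F.join_eqI[OF hfilter_lub_endo_kernel[OF that]] by simp
  have meet: "endo_kernel (\<phi> \<sqinter>\<^bsub>CE\<^esub> \<psi>) = endo_kernel \<phi> \<sqinter>\<^bsub>hfilter_lattice\<^esub> endo_kernel \<psi>"
    if endo: "closure_endo \<phi>" "closure_endo \<psi>" for \<phi> \<psi> :: "'a \<Rightarrow> 'a"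
  proof -
    obtain \<chi> where \<chi>: "closure_endo \<chi>" "endo_kernel \<chi> = endo_kernel \<phi> \<inter> endo_kernel \<psi>"
      using endo by (rule closure_endo_meet_exists)
    have "endo_kernel \<phi> \<sqinter>\<^bsub>hfilter_lattice\<^esub> endo_kernel \<psi> = endo_kernel \<phi> \<inter> endo_kernel \<psi>"
      by (intro F.meet_eqI hfilter_glb hfilter_endo_kernel endo)
    then show ?thesis
      using C.meet_eqI[OF CE_glb[OF endo \<chi>]] \<chi>(2) by simp
  qed
  have "inj_on endo_kernel {\<phi> :: 'a \<Rightarrow> 'a. closure_endo \<phi>}"
    by (intro inj_onI antisym) (auto simp: endo_kernel_subset_iff[symmetric])
  moreover have "endo_kernel \<bottom>\<^bsub>CE :: ('a \<Rightarrow> 'a) gorder\<^esub> = \<bottom>\<^bsub>hfilter_lattice\<^esub>"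
    unfolding C.bottom_eqI[OF CE_least] F.bottom_eqI[OF hfilter_least]
    by (simp add: endo_kernel_def)
  moreover have "endo_kernel \<top>\<^bsub>CE :: ('a \<Rightarrow> 'a) gorder\<^esub> = \<top>\<^bsub>hfilter_lattice\<^esub>"
    unfolding C.top_eqI[OF CE_greatest] F.top_eqI[OF hfilter_greatest]
    by (simp add: endo_kernel_def)
  ultimately show ?thesis
    using join meet C.bounded_lattice_axioms F.bounded_lattice_axioms
      C.lattice_axioms F.lattice_axioms
    by (simp add: bounded_lattice_embedding_def join_pres_def meet_pres_def hfilter_endo_kernel)
qed

theorem theorem4p1:
  shows "bounded_lattice_embedding
           (CE :: ('a::hilbert_algebra \<Rightarrow> 'a) gorder) hfilter_lattice endo_kernel
         \<and> endo_kernel ` carrier (CE :: ('a \<Rightarrow> 'a) gorder) = {J. monomial_filter J}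
         \<and> (\<forall>\<phi> \<in> carrier (CE :: ('a \<Rightarrow> 'a) gorder). \<forall>J. J = endo_kernel \<phi> \<longrightarrow>
              (\<forall>a. is_max (filter_class a J) (\<phi> a)))"
  by (simp add: bounded_lattice_embedding_endo_kernel range_endo_kernel is_max_endo_kernel_class)

end
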